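(* Let $\Gamma$ be the octal game $\mathbf{0.123}$ played under the misère convention: positions are finite collections of heaps of counters, and a move consists of choosing one heap and either (i) removing three counters from it (allowed for any heap of at least three counters), (ii) removing two counters from it, allowed only if the heap has more than two counters, or (iii) removing one counter from it, allowed only if it is the only counter in that heap; the player who makes the last move loses. Let $\mathcal{F}_H$ be the free commutative monoid on the heap alphabet $H=\{h_1,h_2,\dots\}$ (identified with the set of positions, product = disjoint union of heaps), and let $\rho$ be the congruence on $\mathcal{F}_H$ defined by $u\ \rho\ v$ iff for every $w\in\mathcal{F}_H$ the positions $uw$ and $vw$ have the same misère outcome ($P$ or $N$). Then the misère quotient $\mathcal{F}_H/\rho$ is isomorphic to the twenty-element commutative monoid with identity $e$ presented by generators $x,z,a,b$ and relations $$x^2=a^2=e,\quad z^4=z^2,\quad b^4=b^2,\quad abz=b,\quad b^3x=b^2,\quad z^3a=z^2 .$$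
   Context: The heap symbol $h_i$ denotes a single heap of $i$ counters; a position is written as the product of its heaps, and the empty product (no heaps) is the identity. A $P$-position is one in which the previous player wins with best play; an $N$-position is one in which the next player to move wins. The presentation is as a commutative monoid (commutative semigroup with identity $e$). *)

theory Defs
  imports "HOL-Algebra.Group" "HOL-Library.Multiset"
begin

section \<open>Commutative monoids by generators and relations\<close>

definition free_comm_monoid :: "'a set \<Rightarrow> 'a multiset monoid" where
  "free_comm_monoid S = \<lparr>carrier = {M. set_mset M \<subseteq> S}, monoid.mult = (+), one = {#}\<rparr>"

definition monoid_congruence :: "('a, 'm) monoid_scheme \<Rightarrow> ('a \<times> 'a) set \<Rightarrow> bool" where
  "monoid_congruence M r \<longleftrightarrow> equiv (carrier M) r \<and>
     (\<forall>(u, u') \<in> r. \<forall>(v, v') \<in> r. (u \<otimes>\<^bsub>M\<^esub> v, u' \<otimes>\<^bsub>M\<^esub> v') \<in> r)"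

text \<open>Multiplication of classes is written without choosing representatives. When \<open>r\<close> is a
  congruence of \<open>M\<close>, the union below is over copies of one and the same class
  (\<open>quotient_monoid_mult\<close>).\<close>

definition quotient_monoid ::
    "('a, 'm) monoid_scheme \<Rightarrow> ('a \<times> 'a) set \<Rightarrow> 'a set monoid" where
  "quotient_monoid M r =
     \<lparr>carrier = carrier M // r,
      monoid.mult = (\<lambda>X Y. \<Union>u\<in>X. \<Union>v\<in>Y. r `` {u \<otimes>\<^bsub>M\<^esub> v}),
      one = r `` {\<one>\<^bsub>M\<^esub>}\<rparr>"

definition generated_congruence ::
    "('a, 'm) monoid_scheme \<Rightarrow> ('a \<times> 'a) set \<Rightarrow> ('a \<times> 'a) set" where
  "generated_congruence M R = \<Inter>{r. monoid_congruence M r \<and> R \<subseteq> r}"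

definition presented_comm_monoid ::
    "'a set \<Rightarrow> ('a multiset \<times> 'a multiset) set \<Rightarrow> 'a multiset set monoid" where
  "presented_comm_monoid S R =
     quotient_monoid (free_comm_monoid S) (generated_congruence (free_comm_monoid S) R)"

lemma comm_monoid_free_comm_monoid: "comm_monoid (free_comm_monoid S)"
  by unfold_locales (auto simp: free_comm_monoid_def ac_simps)

lemma quotient_monoid_mult:
  assumes r: "monoid_congruence M r" and u: "u \<in> carrier M" and v: "v \<in> carrier M"
  shows "r `` {u} \<otimes>\<^bsub>quotient_monoid M r\<^esub> r `` {v} = r `` {u \<otimes>\<^bsub>M\<^esub> v}"
proof -
  have eq: "equiv (carrier M) r"
    and mult: "\<And>a a' b b'. (a, a') \<in> r \<Longrightarrow> (b, b') \<in> r \<Longrightarrow> (a \<otimes>\<^bsub>M\<^esub> b, a' \<otimes>\<^bsub>M\<^esub> b') \<in> r"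
    using r unfolding monoid_congruence_def by auto
  have self: "u \<in> r `` {u}" "v \<in> r `` {v}"
    using equiv_class_self[OF eq u] equiv_class_self[OF eq v] by simp_all
  have same: "r `` {a \<otimes>\<^bsub>M\<^esub> b} = r `` {u \<otimes>\<^bsub>M\<^esub> v}" if "a \<in> r `` {u}" "b \<in> r `` {v}" for a b
    using that mult[of u a v b] equiv_class_eq[OF eq] by auto
  have "(\<Union>a\<in>r `` {u}. \<Union>b\<in>r `` {v}. r `` {a \<otimes>\<^bsub>M\<^esub> b}) =
        (\<Union>a\<in>r `` {u}. \<Union>b\<in>r `` {v}. r `` {u \<otimes>\<^bsub>M\<^esub> v})"
    using same by (intro SUP_cong refl) auto
  also have "\<dots> = r `` {u \<otimes>\<^bsub>M\<^esub> v}"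
    using self by blast
  finally show ?thesis
    by (simp add: quotient_monoid_def)
qed

lemma comm_monoid_quotient_monoid:
  fixes M (structure)
  assumes "comm_monoid M" and r: "monoid_congruence M r"
  shows "comm_monoid (quotient_monoid M r)"
proof -
  interpret comm_monoid M by fact
  have carrier: "carrier (quotient_monoid M r) = (\<lambda>u. r `` {u}) ` carrier M"
    by (auto simp: quotient_monoid_def quotient_def)
  have one: "\<one>\<^bsub>quotient_monoid M r\<^esub> = r `` {\<one>}"
    by (simp add: quotient_monoid_def)
  show ?thesis
    by (rule comm_monoidI)
      (auto simp: carrier one quotient_monoid_mult[OF r] m_ac)
qed

lemma monoid_congruence_generated:
  fixes M (structure)
  assumes "comm_monoid M" and R: "R \<subseteq> carrier M \<times> carrier M"
  shows "monoid_congruence M (generated_congruence M R)"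
proof -
  interpret comm_monoid M by fact
  let ?C = "{r. monoid_congruence M r \<and> R \<subseteq> r}"
  have full: "carrier M \<times> carrier M \<in> ?C"
    using R by (auto simp: monoid_congruence_def equiv_def refl_on_def sym_def trans_def)
  have C: "equiv (carrier M) r" if "r \<in> ?C" for r
    using that by (auto simp: monoid_congruence_def)
  have sub: "\<Inter>?C \<subseteq> carrier M \<times> carrier M"
    using full by blast
  have "equiv (carrier M) (\<Inter>?C)"
  proof (rule equivI)
    show "refl_on (carrier M) (\<Inter>?C)"
      using C unfolding equiv_def refl_on_def by blast
    show "sym (\<Inter>?C)"
      using C unfolding equiv_def sym_def by blast
    show "trans (\<Inter>?C)"
      using C unfolding equiv_def trans_def by blast
  qed (rule sub)
  moreover have "(u \<otimes> v, u' \<otimes> v') \<in> \<Inter>?C"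
    if "(u, u') \<in> \<Inter>?C" "(v, v') \<in> \<Inter>?C" for u u' v v'
  proof
    fix r assume r: "r \<in> ?C"
    then have "(u, u') \<in> r" "(v, v') \<in> r"
      using that by blast+
    then show "(u \<otimes> v, u' \<otimes> v') \<in> r"
      using r by (auto simp: monoid_congruence_def)
  qed
  ultimately show ?thesis
    unfolding generated_congruence_def monoid_congruence_def[of M "\<Inter>?C"] by blast
qed

section \<open>The octal game 0.123 in misere play\<close>

text \<open>The heap \<open>h\<^sub>i\<close> is the number \<open>i > 0\<close>, and a position is the multiset of its heaps.\<close>

definition positions :: "nat multiset monoid" where
  "positions = free_comm_monoid {0<..}"

text \<open>\<open>heap_move n H\<close>: a single heap of \<open>n\<close> counters can be replaced by the heaps \<open>H\<close>.\<close>

inductive heap_move :: "nat \<Rightarrow> nat multiset \<Rightarrow> bool" where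
  remove_one: "heap_move 1 {#}"
| remove_two: "n > 2 \<Longrightarrow> heap_move n {#n - 2#}"
| remove_three_all: "heap_move 3 {#}"
| remove_three: "n > 3 \<Longrightarrow> heap_move n {#n - 3#}"

inductive move :: "nat multiset \<Rightarrow> nat multiset \<Rightarrow> bool" where
  "heap_move n H \<Longrightarrow> move (add_mset n G) (G + H)"

lemma move_positions:
  assumes "move G G'" "G \<in> carrier positions"
  shows "G' \<in> carrier positions"
  using assms by (auto simp: positions_def free_comm_monoid_def elim!: move.cases heap_move.cases)

lemma move_decreases: "move G G' \<Longrightarrow> sum_mset G' < sum_mset G"
  by (auto elim!: move.cases heap_move.cases)

datatype outcome = P_position | N_position

text \<open>The player to move at a position without moves wins, since the opponent made the last
  move.\<close>

context
  notes conj_cong [fundef_cong]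
begin

function misere_outcome :: "nat multiset \<Rightarrow> outcome" where
  "misere_outcome G =
     (if (\<nexists>G'. move G G') \<or> (\<exists>G'. move G G' \<and> misere_outcome G' = P_position)
      then N_position else P_position)"
  by auto
termination
  by (relation "measure sum_mset") (auto simp: move_decreases)

end

declare misere_outcome.simps [simp del]

definition misere_congruence :: "(nat multiset \<times> nat multiset) set" where
  "misere_congruence =
     {(u, v). u \<in> carrier positions \<and> v \<in> carrier positions \<and>
        (\<forall>w \<in> carrier positions.
           misere_outcome (u \<otimes>\<^bsub>positions\<^esub> w) = misere_outcome (v \<otimes>\<^bsub>positions\<^esub> w))}"

definition misere_quotient :: "nat multiset set monoid" where
  "misere_quotient = quotient_monoid positions misere_congruence"

lemma monoid_congruence_misere: "monoid_congruence positions misere_congruence"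
proof -
  interpret comm_monoid positions
    unfolding positions_def by (rule comm_monoid_free_comm_monoid)
  have "equiv (carrier positions) misere_congruence"
    by (auto simp: misere_congruence_def intro!: equivI refl_onI symI transI)
  moreover have "(u \<otimes>\<^bsub>positions\<^esub> v, u' \<otimes>\<^bsub>positions\<^esub> v') \<in> misere_congruence"
    if u: "(u, u') \<in> misere_congruence" and v: "(v, v') \<in> misere_congruence" for u u' v v'
  proof -
    have mem: "u \<in> carrier positions" "u' \<in> carrier positions"
      "v \<in> carrier positions" "v' \<in> carrier positions"
      using u v by (auto simp: misere_congruence_def)
    have "misere_outcome ((u \<otimes>\<^bsub>positions\<^esub> v) \<otimes>\<^bsub>positions\<^esub> w) =
          misere_outcome ((u' \<otimes>\<^bsub>positions\<^esub> v') \<otimes>\<^bsub>positions\<^esub> w)"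
      if w: "w \<in> carrier positions" for w
    proof -
      have "misere_outcome (u \<otimes>\<^bsub>positions\<^esub> (v \<otimes>\<^bsub>positions\<^esub> w)) =
            misere_outcome (u' \<otimes>\<^bsub>positions\<^esub> (v \<otimes>\<^bsub>positions\<^esub> w))"
        using u w mem by (simp add: misere_congruence_def)
      also have "\<dots> = misere_outcome (v \<otimes>\<^bsub>positions\<^esub> (u' \<otimes>\<^bsub>positions\<^esub> w))"
        using w mem by (simp add: m_lcomm)
      also have "\<dots> = misere_outcome (v' \<otimes>\<^bsub>positions\<^esub> (u' \<otimes>\<^bsub>positions\<^esub> w))"
        using v w mem by (simp add: misere_congruence_def)
      finally show ?thesis
        using w mem by (simp add: m_assoc m_lcomm)
    qed
    then show ?thesis
      using mem by (simp add: misere_congruence_def)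
  qed
  ultimately show ?thesis
    unfolding monoid_congruence_def by auto
qed

section \<open>The presentation\<close>

datatype gen = gen_x | gen_z | gen_a | gen_b

definition relations_0123 :: "(gen multiset \<times> gen multiset) set" where
  "relations_0123 =
     {(replicate_mset 2 gen_x, {#}),
      (replicate_mset 2 gen_a, {#}),
      (replicate_mset 4 gen_z, replicate_mset 2 gen_z),
      (replicate_mset 4 gen_b, replicate_mset 2 gen_b),
      ({#gen_a, gen_b, gen_z#}, {#gen_b#}),
      (replicate_mset 3 gen_b + {#gen_x#}, replicate_mset 2 gen_b),
      (replicate_mset 3 gen_z + {#gen_a#}, replicate_mset 2 gen_z)}"

end

(* Heaps get the values h1 = x, h2 = e, h3 = h4 = z, and from h5 on, with period 5, the values
   x, b^2, e, a, b. A word in x, a, z, b is a P-word if its class is one of x, xa, z^2, ab, b^2.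
   No move leads from a P-position to a P-position by inspection of the eleven heap types (the
   value of a heap together with the values of its options). Conversely, from a position with
   moves that is not P, the exponents of its word already determine a move to a P-position,
   except for not knowing whether an even power of b comes from heaps b or heaps b^2. Since
   multiplying by further words separates any two of the twenty classes, the misere congruence
   is the word problem of the presentation, which a terminating rewriting system solves. *)

theory Submission
  imports Defs
begin

section \<open>Congruences\<close>

lemma generated_congruence_least:
  "monoid_congruence M r \<Longrightarrow> R \<subseteq> r \<Longrightarrow> generated_congruence M R \<subseteq> r"
  by (auto simp: generated_congruence_def)

lemma generated_congruence_superset: "R \<subseteq> generated_congruence M R"
  by (auto simp: generated_congruence_def)

text \<open>The isomorphism is induced by \<open>f\<close>. Read from left to right,
  \<open>rel\<close> makes the map on classes well defined; read from right to left, it makes the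
  map injective.\<close>

lemma quotient_monoid_iso:
  assumes r: "monoid_congruence M r" and s: "monoid_congruence N s"
    and M: "monoid M"
    and f: "f \<in> hom M N" and surj: "f ` carrier M = carrier N"
    and rel: "\<And>u v. u \<in> carrier M \<Longrightarrow> v \<in> carrier M \<Longrightarrow> (u, v) \<in> r \<longleftrightarrow> (f u, f v) \<in> s"
  shows "quotient_monoid M r \<cong> quotient_monoid N s"
proof -
  have er: "equiv (carrier M) r" and es: "equiv (carrier N) s"
    using r s by (auto simp: monoid_congruence_def)
  have sub: "r \<subseteq> carrier M \<times> carrier M" "s \<subseteq> carrier N \<times> carrier N"
    using er es by (auto simp: equiv_def)
  have fN: "f u \<in> carrier N" if "u \<in> carrier M" for u
    using that surj by blast
  \<comment> \<open>Saturating the image under \<open>s\<close> avoids choosing a representative of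
    \<open>X\<close>.\<close>
  define F where "F X = s `` (f ` X)" for X
  have F: "F (r `` {u}) = s `` {f u}" if u: "u \<in> carrier M" for u
  proof (rule Set.set_eqI)
    fix y
    show "y \<in> F (r `` {u}) \<longleftrightarrow> y \<in> s `` {f u}"
    proof
      assume "y \<in> F (r `` {u})"
      then obtain v where v: "(u, v) \<in> r" "(f v, y) \<in> s"
        by (auto simp: F_def)
      with sub u have "(f u, f v) \<in> s"
        using rel by blast
      with v es show "y \<in> s `` {f u}"
        by (auto simp: equiv_def dest: transD)
    next
      assume "y \<in> s `` {f u}"
      then show "y \<in> F (r `` {u})"
        using equiv_class_self[OF er u] by (auto simp: F_def)
    qed
  qed
  have eq: "s `` {f u} = s `` {f v} \<longleftrightarrow> r `` {u} = r `` {v}"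
    if "u \<in> carrier M" "v \<in> carrier M" for u v
    using that rel fN by (simp add: eq_equiv_class_iff[OF er] eq_equiv_class_iff[OF es])
  have cM: "carrier (quotient_monoid M r) = (\<lambda>u. r `` {u}) ` carrier M"
    and cN: "carrier (quotient_monoid N s) = (\<lambda>u. s `` {f u}) ` carrier M"
    by (auto simp: quotient_monoid_def quotient_def simp flip: surj)
  have "F \<in> iso (quotient_monoid M r) (quotient_monoid N s)"
  proof (rule isoI)
    show "F \<in> hom (quotient_monoid M r) (quotient_monoid N s)"
    proof (rule homI)
      fix X assume "X \<in> carrier (quotient_monoid M r)"
      then show "F X \<in> carrier (quotient_monoid N s)"
        by (auto simp: cM cN F)
    next
      fix X Y assume "X \<in> carrier (quotient_monoid M r)" "Y \<in> carrier (quotient_monoid M r)"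
      then obtain u v where uv: "X = r `` {u}" "Y = r `` {v}" "u \<in> carrier M" "v \<in> carrier M"
        by (auto simp: cM)
      then show "F (X \<otimes>\<^bsub>quotient_monoid M r\<^esub> Y) = F X \<otimes>\<^bsub>quotient_monoid N s\<^esub> F Y"
        using monoid.m_closed[OF M] f
        by (simp add: F fN quotient_monoid_mult[OF r] quotient_monoid_mult[OF s] hom_mult)
    qed
    show "bij_betw F (carrier (quotient_monoid M r)) (carrier (quotient_monoid N s))"
      unfolding bij_betw_def inj_on_def by (auto simp: cM cN F eq image_image)
  qed
  then show ?thesis
    by (rule is_isoI)
qed

text \<open>The classes are the nonempty fibres of \<open>f\<close>, one for each value.\<close>

lemma card_quotient_kernel: "card (A // {(u, v). u \<in> A \<and> v \<in> A \<and> f u = f v}) = card (f ` A)"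
proof -
  let ?r = "{(u, v). u \<in> A \<and> v \<in> A \<and> f u = f v}" and ?g = "\<lambda>y. {v \<in> A. f v = y}"
  have "A // ?r = (\<lambda>u. ?r `` {u}) ` A"
    by (auto simp: quotient_def)
  also have "\<dots> = (\<lambda>u. ?g (f u)) ` A"
    by (rule image_cong) auto
  finally have "A // ?r = ?g ` f ` A"
    by (simp add: image_image)
  moreover have "inj_on ?g (f ` A)"
    by (auto simp: inj_on_def)
  ultimately show ?thesis
    by (simp add: card_image)
qed

section \<open>The word problem of the presentation\<close>

text \<open>Since \<open>bz = ab\<close> and \<open>b\<^sup>3 = b\<^sup>2x\<close>, the exponents of \<open>x\<close> and \<open>b\<close> and those of \<open>a\<close> and \<open>z\<close>
  have an invariant joint parity, and the number of \<open>z\<close> is visible only in the absence of \<open>b\<close>.\<close>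

definition word_invariant :: "gen multiset \<Rightarrow> bool \<times> bool \<times> nat \<times> nat" where
  "word_invariant w =
     (even (count w gen_x + count w gen_b), even (count w gen_a + count w gen_z),
      if count w gen_b = 0 then min (count w gen_z) 2 else 0, min (count w gen_b) 2)"

text \<open>In each of the five cases the \<open>if\<close> and the \<open>min\<close> of
  \<open>word_invariant\<close> become constants and only the two parities remain, whence 5 * 4 = 20
  classes.\<close>

lemma word_cases:
  obtains "count w gen_b = 0" "count w gen_z = 0" | "count w gen_b = 0" "count w gen_z = 1"
  | "count w gen_b = 0" "count w gen_z \<ge> 2" | "count w gen_b = 1" | "count w gen_b \<ge> 2"
  by linarith

text \<open>Parities and truncation at 2 respect addition. The number of \<open>z\<close> is hidden
  once a \<open>b\<close> occurs, but a product without \<open>b\<close> has two factors without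
  \<open>b\<close>, whose invariants do show it.\<close>

lemma word_invariant_add:
  assumes "word_invariant u = word_invariant u'" "word_invariant v = word_invariant v'"
  shows "word_invariant (u + v) = word_invariant (u' + v')"
proof -
  have min_add: "min (m + n) 2 = min (m' + n') 2"
    if "min m 2 = min m' 2" "min n 2 = min n' 2" for m n m' n' :: nat
    using that by linarith
  have zero: "m = 0 \<longleftrightarrow> n = 0" if "min m 2 = min n 2" for m n :: nat
    using that by linarith
  have b: "min (count u gen_b) 2 = min (count u' gen_b) 2"
    "min (count v gen_b) 2 = min (count v' gen_b) 2"
    using assms by (simp_all add: word_invariant_def)
  note b_zero = zero[OF b(1)] zero[OF b(2)]
  have z: "min (count (u + v) gen_z) 2 = min (count (u' + v') gen_z) 2"
    if "count (u' + v') gen_b = 0"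
    using that assms b_zero unfolding count_union
    by (intro min_add) (simp_all add: word_invariant_def)
  have "min (count (u + v) gen_b) 2 = min (count (u' + v') gen_b) 2"
    unfolding count_union using b by (rule min_add)
  moreover have "count (u + v) gen_b = 0 \<longleftrightarrow> count (u' + v') gen_b = 0"
    unfolding count_union using b_zero by simp
  then have "(if count (u + v) gen_b = 0 then min (count (u + v) gen_z) 2 else 0) =
      (if count (u' + v') gen_b = 0 then min (count (u' + v') gen_z) 2 else 0)"
    by (rule if_cong) (erule z, rule refl)
  moreover have "even (count (u + v) gen_x + count (u + v) gen_b) =
      even (count (u' + v') gen_x + count (u' + v') gen_b)"
    "even (count (u + v) gen_a + count (u + v) gen_z) =
      even (count (u' + v') gen_a + count (u' + v') gen_z)"
    using assms by (auto simp: word_invariant_def)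
  ultimately show ?thesis
    by (simp only: word_invariant_def)
qed

abbreviation words :: "gen multiset monoid" where
  "words \<equiv> free_comm_monoid UNIV"

abbreviation word_congruence :: "(gen multiset \<times> gen multiset) set" where
  "word_congruence \<equiv> generated_congruence words relations_0123"

lemma monoid_congruence_word: "monoid_congruence words word_congruence"
  by (rule monoid_congruence_generated[OF comm_monoid_free_comm_monoid])
    (auto simp: free_comm_monoid_def)

text \<open>The kernel of \<open>word_invariant\<close> is a congruence containing the relations, so
  it contains the least one.\<close>

lemma word_congruence_invariant:
  assumes "(u, v) \<in> word_congruence"
  shows "word_invariant u = word_invariant v"
proof -
  let ?r = "{(u, v). word_invariant u = word_invariant v}"
  have "monoid_congruence words ?r"
    unfolding monoid_congruence_def
  proof
    show "equiv (carrier words) ?r"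
      by (auto simp: free_comm_monoid_def intro!: equivI refl_onI symI transI)
    show "\<forall>(u, u') \<in> ?r. \<forall>(v, v') \<in> ?r. (u \<otimes>\<^bsub>words\<^esub> v, u' \<otimes>\<^bsub>words\<^esub> v') \<in> ?r"
      by (clarsimp simp: free_comm_monoid_def) (rule word_invariant_add)
  qed
  moreover have "relations_0123 \<subseteq> ?r"
    by (auto simp: relations_0123_def word_invariant_def)
  ultimately show ?thesis
    using assms generated_congruence_least by blast
qed

lemma word_congruence_refl: "(u, u) \<in> word_congruence"
  and word_congruence_sym: "(u, v) \<in> word_congruence \<Longrightarrow> (v, u) \<in> word_congruence"
  and word_congruence_trans:
    "(u, v) \<in> word_congruence \<Longrightarrow> (v, w) \<in> word_congruence \<Longrightarrow> (u, w) \<in> word_congruence"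
  and word_congruence_add:
    "(u, u') \<in> word_congruence \<Longrightarrow> (v, v') \<in> word_congruence \<Longrightarrow> (u + v, u' + v') \<in> word_congruence"
proof -
  have eq: "equiv UNIV word_congruence"
    and add: "\<forall>(u, u') \<in> word_congruence. \<forall>(v, v') \<in> word_congruence.
      (u + v, u' + v') \<in> word_congruence"
    using monoid_congruence_word by (simp_all add: monoid_congruence_def free_comm_monoid_def)
  show "(u, u) \<in> word_congruence"
    and "(u, v) \<in> word_congruence \<Longrightarrow> (v, u) \<in> word_congruence"
    and "(u, v) \<in> word_congruence \<Longrightarrow> (v, w) \<in> word_congruence \<Longrightarrow> (u, w) \<in> word_congruence"
    using eq by (auto simp: equiv_def refl_on_def dest: symD transD)
  show "(u, u') \<in> word_congruence \<Longrightarrow> (v, v') \<in> word_congruence \<Longrightarrow> (u + v, u' + v') \<in> word_congruence"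
    using add by blast
qed

section \<open>Normal forms by rewriting\<close>

inductive rewrite_rule :: "gen multiset \<Rightarrow> gen multiset \<Rightarrow> bool" where
  "rewrite_rule {#gen_x, gen_x#} {#}"
| "rewrite_rule {#gen_a, gen_a#} {#}"
| "rewrite_rule {#gen_z, gen_z, gen_z#} {#gen_z, gen_z, gen_a#}"
| "rewrite_rule {#gen_b, gen_z#} {#gen_a, gen_b#}"
| "rewrite_rule {#gen_b, gen_b, gen_b#} {#gen_b, gen_b, gen_x#}"

lemma rewrite_rule_congruence:
  assumes "rewrite_rule s t"
  shows "(s, t) \<in> word_congruence"
proof -
  have rel: "(s, t) \<in> word_congruence" if "(s, t) \<in> relations_0123" for s t
    using that generated_congruence_superset by blast
  have xx: "({#gen_x, gen_x#}, {#}) \<in> word_congruence"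
    and aa: "({#gen_a, gen_a#}, {#}) \<in> word_congruence"
    and abz: "({#gen_a, gen_b, gen_z#}, {#gen_b#}) \<in> word_congruence"
    and bbbx: "({#gen_b, gen_b, gen_b, gen_x#}, {#gen_b, gen_b#}) \<in> word_congruence"
    and zzza: "({#gen_z, gen_z, gen_z, gen_a#}, {#gen_z, gen_z#}) \<in> word_congruence"
    by (rule rel, simp add: relations_0123_def numeral_eq_Suc)+
  \<comment> \<open>A rule whose relation carries a surplus involution is obtained by multiplying with it.\<close>
  have cancel: "(s, t + {#g#}) \<in> word_congruence"
    if "({#g, g#}, {#}) \<in> word_congruence" "(s + {#g#}, t) \<in> word_congruence" for g s t
  proof -
    have 1: "(s, s + {#g#} + {#g#}) \<in> word_congruence"
      using word_congruence_add[OF word_congruence_refl word_congruence_sym[OF that(1)], of s]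
      by simp
    have 2: "(s + {#g#} + {#g#}, t + {#g#}) \<in> word_congruence"
      by (rule word_congruence_add[OF that(2) word_congruence_refl])
    show ?thesis
      by (rule word_congruence_trans[OF 1 2])
  qed
  show ?thesis
    using assms
  proof cases
    case 3
    then show ?thesis
      using cancel[OF aa, of "{#gen_z, gen_z, gen_z#}" "{#gen_z, gen_z#}"] zzza by (simp add: add_mset_commute)
  next
    case 4
    then show ?thesis
      using cancel[OF aa, of "{#gen_b, gen_z#}" "{#gen_b#}"] abz by (simp add: add_mset_commute)
  next
    case 5
    then show ?thesis
      using cancel[OF xx, of "{#gen_b, gen_b, gen_b#}" "{#gen_b, gen_b#}"] bbbx by (simp add: add_mset_commute)
  qed (simp_all add: xx aa)
qed

text \<open>Three of the rules keep the length and only trade a \<open>z\<close> for an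
  \<open>a\<close> or a \<open>b\<close> for an \<open>x\<close>. Counting \<open>z\<close> and
  \<open>b\<close> twice makes these trades decrease too.\<close>

lemma rewrite_rule_decreases:
  assumes "rewrite_rule s t"
  shows "2 * count t gen_z + 2 * count t gen_b + count t gen_x + count t gen_a
    < 2 * count s gen_z + 2 * count s gen_b + count s gen_x + count s gen_a"
  using assms by cases simp_all

definition reduced :: "gen multiset \<Rightarrow> bool" where
  "reduced w \<longleftrightarrow> (\<nexists>s t. rewrite_rule s t \<and> s \<subseteq># w)"

lemma ex_reduced: "\<exists>v. reduced v \<and> (w, v) \<in> word_congruence"
proof (induction "2 * count w gen_z + 2 * count w gen_b + count w gen_x + count w gen_a"
    arbitrary: w rule: less_induct)
  case less
  show ?case
  proof (cases "reduced w")
    case True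
    then show ?thesis
      using word_congruence_refl by blast
  next
    case False
    then obtain s t u where st: "rewrite_rule s t" and w: "w = s + u"
      by (auto simp: reduced_def subset_mset.le_iff_add)
    have "\<exists>v. reduced v \<and> (t + u, v) \<in> word_congruence"
      using rewrite_rule_decreases[OF st] by (intro less) (simp add: w)
    moreover have "(w, t + u) \<in> word_congruence"
      unfolding w
      by (rule word_congruence_add[OF rewrite_rule_congruence[OF st] word_congruence_refl])
    ultimately show ?thesis
      using word_congruence_trans by blast
  qed
qed

text \<open>Each conclusion says that one left-hand side does not occur. Together they leave x^i a^j
  with i, j < 2, times one of e, z, z^2, b, b^2.\<close>

lemma reduced_counts:
  assumes "reduced w"
  shows "count w gen_x < 2" "count w gen_a < 2" "count w gen_z < 3" "count w gen_b < 3"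
    "count w gen_b = 0 \<or> count w gen_z = 0"
proof -
  have red: "\<not> s \<subseteq># w" if "rewrite_rule s t" for s t
    using that assms by (auto simp: reduced_def)
  have pow: "replicate_mset n g \<subseteq># w" if "n \<le> count w g" for n g
    using that by (simp add: count_le_replicate_mset_subset_eq)
  show "count w gen_x < 2"
    using red[OF rewrite_rule.intros(1)] pow[of 2 gen_x] by (force simp: numeral_eq_Suc)
  show "count w gen_a < 2"
    using red[OF rewrite_rule.intros(2)] pow[of 2 gen_a] by (force simp: numeral_eq_Suc)
  show "count w gen_z < 3"
    using red[OF rewrite_rule.intros(3)] pow[of 3 gen_z] by (force simp: numeral_eq_Suc)
  show "count w gen_b < 3"
    using red[OF rewrite_rule.intros(5)] pow[of 3 gen_b] by (force simp: numeral_eq_Suc)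
  show "count w gen_b = 0 \<or> count w gen_z = 0"
    using red[OF rewrite_rule.intros(4)]
    by (auto simp: insert_subset_eq_iff in_diff_count simp flip: count_greater_zero_iff)
qed

text \<open>On reduced words truncation loses nothing, no \<open>z\<close> is hidden by a
  \<open>b\<close>, and exponents below 2 are known from their parities. Normal forms are thus
  unique without any analysis of critical pairs.\<close>

lemma reduced_eqI:
  assumes "reduced u" "reduced v" "word_invariant u = word_invariant v"
  shows "u = v"
proof -
  have parity: "m = n" if "even m = even n" "m < 2" "n < 2" for m n :: nat
    using that by (cases m; cases n) (auto simp: less_Suc_eq numeral_eq_Suc)
  note u = reduced_counts[OF assms(1)] and v = reduced_counts[OF assms(2)]
  have b: "count u gen_b = count v gen_b"
    using assms(3) u(4) v(4) by (auto simp: word_invariant_def)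
  have z: "count u gen_z = count v gen_z"
    using assms(3) u(3,5) v(3,5) b by (auto simp: word_invariant_def split: if_splits)
  have "count u gen_x = count v gen_x" "count u gen_a = count v gen_a"
    using assms(3) b z u(1,2) v(1,2) by (auto simp: word_invariant_def intro!: parity)
  then have "count u g = count v g" for g
    using b z by (cases g) simp_all
  then show ?thesis
    by (simp add: multiset_eq_iff)
qed

lemma word_congruence_iff: "(u, v) \<in> word_congruence \<longleftrightarrow> word_invariant u = word_invariant v"
proof
  assume eq: "word_invariant u = word_invariant v"
  obtain u' v' where u': "reduced u'" "(u, u') \<in> word_congruence"
    and v': "reduced v'" "(v, v') \<in> word_congruence"
    using ex_reduced by meson
  have "u' = v'"
    using u' v' eq by (intro reduced_eqI) (auto dest!: word_congruence_invariant)
  then show "(u, v) \<in> word_congruence"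
    using u' v' by (blast intro: word_congruence_trans word_congruence_sym)
qed (rule word_congruence_invariant)

section \<open>The number of classes\<close>

lemma range_word_invariant:
  "range word_invariant = UNIV \<times> UNIV \<times> {(0, 0), (1, 0), (2, 0), (0, 1), (0, 2)}"
proof (intro equalityI subsetI)
  fix y :: "bool \<times> bool \<times> nat \<times> nat"
  assume "y \<in> UNIV \<times> UNIV \<times> {(0, 0), (1, 0), (2, 0), (0, 1), (0, 2)}"
  then obtain p q k l where y: "y = (p, q, k, l)"
    and kl: "(k, l) \<in> {(0, 0), (1, 0), (2, 0), (0, 1), (0, 2)}"
    by auto
  \<comment> \<open>The \<open>l\<close> extra letters \<open>x\<close> and \<open>k\<close> extra
    letters \<open>a\<close> balance the \<open>b\<close> and \<open>z\<close> in the two parities,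
    which \<open>of_bool\<close> then sets as required.\<close>
  define w where "w = replicate_mset (l + of_bool (\<not> p)) gen_x +
    replicate_mset (k + of_bool (\<not> q)) gen_a + replicate_mset k gen_z + replicate_mset l gen_b"
  have "word_invariant w = y"
    using kl by (auto simp: w_def y word_invariant_def)
  then show "y \<in> range word_invariant"
    by blast
next
  fix y assume "y \<in> range word_invariant"
  then obtain w where "y = word_invariant w"
    by blast
  then show "y \<in> UNIV \<times> UNIV \<times> {(0, 0), (1, 0), (2, 0), (0, 1), (0, 2)}"
    by (cases w rule: word_cases) (simp_all add: word_invariant_def del: count_eq_zero_iff)
qed

lemma card_presented: "card (carrier (presented_comm_monoid UNIV relations_0123)) = 20"
proof -
  have "word_congruence = {(u, v). u \<in> UNIV \<and> v \<in> UNIV \<and> word_invariant u = word_invariant v}"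
    by (auto simp: word_congruence_iff)
  then have "card (carrier (presented_comm_monoid UNIV relations_0123)) = card (range word_invariant)"
    using card_quotient_kernel[of UNIV word_invariant]
    by (simp add: presented_comm_monoid_def quotient_monoid_def free_comm_monoid_def)
  also have "\<dots> = 20"
    by (simp add: range_word_invariant card_cartesian_product)
  finally show ?thesis .
qed

section \<open>Outcomes\<close>

definition heap_word :: "nat \<Rightarrow> gen multiset" where
  "heap_word n =
     (if n = 1 then {#gen_x#}
      else if n = 3 \<or> n = 4 then {#gen_z#}
      else if n mod 5 = 0 then {#gen_x#}
      else if n mod 5 = 1 then {#gen_b, gen_b#}
      else if n mod 5 = 2 then {#}
      else if n mod 5 = 3 then {#gen_a#}
      else {#gen_b#})"

definition position_word :: "nat multiset \<Rightarrow> gen multiset" where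
  "position_word G = \<Sum>\<^sub># (image_mset heap_word G)"

lemma position_word_simps [simp]:
  "position_word {#} = {#}"
  "position_word (add_mset n G) = heap_word n + position_word G"
  "position_word (G + G') = position_word G + position_word G'"
  by (simp_all add: position_word_def)

text \<open>The invariants of x, xa, z^2, ab, b^2, in this order.\<close>

definition p_word :: "gen multiset \<Rightarrow> bool" where
  "p_word w \<longleftrightarrow> word_invariant w \<in>
     {(False, True, 0, 0), (False, False, 0, 0), (True, True, 2, 0),
      (False, False, 0, 1), (True, True, 0, 2)}"

text \<open>The arguments stand for the exponents of x, a, z, b. As bare numbers they turn moves
  into arithmetic within reach of \<open>presburger\<close>.\<close>

definition p_counts :: "nat \<Rightarrow> nat \<Rightarrow> nat \<Rightarrow> nat \<Rightarrow> bool" where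
  "p_counts i j k l \<longleftrightarrow>
     (if l = 0 then
        (if k = 0 then odd i else k \<noteq> 1 \<and> even i \<and> even (j + k))
      else if l = 1 then even i \<and> odd (j + k)
      else even (i + l) \<and> even (j + k))"

lemma p_word_counts:
  "p_word w \<longleftrightarrow> p_counts (count w gen_x) (count w gen_a) (count w gen_z) (count w gen_b)"
  by (cases w rule: word_cases)
    (auto simp: p_word_def p_counts_def word_invariant_def simp del: count_eq_zero_iff)

lemmas p_word_iff = p_word_counts[unfolded p_counts_def]

text \<open>Multiplying by \<open>b\<^sup>2\<close> leaves only the two parities visible. Once the parities are known,
  the products with the involutions \<open>x\<close>, \<open>a\<close>, possibly times \<open>b\<close>, read off the rest.\<close>

lemma p_word_separates:
  assumes "\<And>w. p_word (u + w) = p_word (v + w)"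
  shows "word_invariant u = word_invariant v"
proof -
  \<comment> \<open>Of the four classes divisible by b^2 only b^2 itself is P, so multiplying by b^2
    and by each of e, x, a, xa reveals both parities.\<close>
  have par: "even (count u gen_x + count u gen_b) = even (count v gen_x + count v gen_b)"
    "even (count u gen_a + count u gen_z) = even (count v gen_a + count v gen_z)"
    using assms[of "{#gen_b, gen_b#}"] assms[of "{#gen_b, gen_b, gen_x#}"]
      assms[of "{#gen_b, gen_b, gen_a#}"] assms[of "{#gen_b, gen_b, gen_x, gen_a#}"]
    by (simp_all add: p_word_iff) argo+
  \<comment> \<open>A word in \<open>x\<close> and \<open>a\<close> that makes both parities of
    \<open>u + s\<close> even and, by \<open>par\<close>, those of \<open>v + s\<close>.\<close>
  obtain s where s: "even (count u gen_x + count u gen_b + count s gen_x)"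
    "even (count u gen_a + count u gen_z + count s gen_a)"
    "count s gen_z = 0" "count s gen_b = 0"
  proof
    let ?s = "replicate_mset (count u gen_x + count u gen_b) gen_x +
      replicate_mset (count u gen_a + count u gen_z) gen_a"
    show "even (count u gen_x + count u gen_b + count ?s gen_x)"
      "even (count u gen_a + count u gen_z + count ?s gen_a)"
      "count ?s gen_z = 0" "count ?s gen_b = 0"
      by simp_all
  qed
  \<comment> \<open>Now \<open>u + s\<close> is in the class of e, az, z^2, xb or b^2. With P for a
    P-word and N otherwise, the four tests read NPPN, NNNN, PNNN, NNPP, PNNP respectively, all
    different.\<close>
  note tests = assms[of s] assms[of "s + {#gen_x#}"] assms[of "s + {#gen_x, gen_a#}"]
    assms[of "s + {#gen_b, gen_x#}"]
  show ?thesis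
    using tests par s
    by (cases u rule: word_cases; cases v rule: word_cases)
      (simp_all add: word_invariant_def p_word_iff del: count_eq_zero_iff, argo+)
qed

text \<open>The hypotheses say that none of the moves known to be available reaches a P-word. In the
  last one, an odd exponent of \<open>b\<close> forces a heap of value \<open>b\<close>, while a heap of value \<open>b\<^sup>2\<close> is of one of
  two types.\<close>

lemma p_counts_stuck:
  assumes "\<not> p_counts i j k l"
    and x: "i > 0 \<Longrightarrow> \<not> p_counts (i - 1) j k l"
    and a: "j > 0 \<Longrightarrow> \<not> p_counts (i + 1) (j - 1) k l \<and> \<not> p_counts i (j - 1) k (l + 2)"
    and z: "k > 0 \<Longrightarrow> \<not> p_counts i j (k - 1) l \<and> \<not> p_counts (i + 1) j (k - 1) l"
    and b: "l > 0 \<Longrightarrow> \<not> p_counts i j k (l - 1) \<and> \<not> p_counts i j k (l + 1) \<or>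
      even l \<and> (\<not> p_counts i j (k + 1) (l - 2) \<or>
        \<not> p_counts i j k (l - 1) \<and> \<not> p_counts i (j + 1) k (l - 2))"
  shows "i = 0 \<and> j = 0 \<and> k = 0 \<and> l = 0"
proof -
  \<comment> \<open>Moves lower \<open>k\<close> by at most one and \<open>l\<close> by at most two;
    the split sets apart small values near which \<open>p_counts\<close> changes its form.\<close>
  consider "l = 0" "k = 0" | "l = 0" "k = 1" | "l = 0" "k = 2" | "l = 0" "k > 2"
   | "l = 1" | "l = 2" "k = 0" | "l = 2" "k > 0" | "l = 3" | "l > 3"
    by linarith
  then show ?thesis
  proof cases
    case 1
    then show ?thesis using assms unfolding p_counts_def by simp presburger
  next
    case 2
    then show ?thesis using assms unfolding p_counts_def by simp
  next
    case 3
    then show ?thesis using assms unfolding p_counts_def by simp presburger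
  next
    case 4
    then show ?thesis using assms unfolding p_counts_def by simp presburger
  next
    case 5
    then show ?thesis using assms unfolding p_counts_def by simp presburger
  next
    \<comment> \<open>Trading b^2 for z leads to x^i a^j z, never a P-word, so \<open>b\<close>
      gives nothing here. But \<open>i\<close> or \<open>j\<close> is odd, and a move on an
      \<open>x\<close> or an \<open>a\<close> reaches a P-word.\<close>
    case 6
    then show ?thesis using assms unfolding p_counts_def by simp presburger
  next
    case 7
    then show ?thesis using assms unfolding p_counts_def by simp presburger
  next
    case 8
    then show ?thesis using assms unfolding p_counts_def by simp presburger
  next
    case 9
    then show ?thesis using assms unfolding p_counts_def by simp presburger
  qed
qed

section \<open>Heap values and the values of their options\<close>

definition heap_opts :: "nat \<Rightarrow> gen multiset set" where
  "heap_opts n = position_word ` {H. heap_move n H}"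

text \<open>In order, the types of the heaps 1, 2, 3 (shared with 4), 5, 6, and so on up to
  12.\<close>

definition heap_types :: "(gen multiset \<times> gen multiset set) set" where
  "heap_types =
     {({#gen_x#}, {{#}}), ({#}, {}), ({#gen_z#}, {{#gen_x#}, {#}}),
      ({#gen_x#}, {{#gen_z#}, {#}}), ({#gen_b, gen_b#}, {{#gen_z#}}),
      ({#}, {{#gen_x#}, {#gen_z#}}), ({#gen_a#}, {{#gen_b, gen_b#}, {#gen_x#}}),
      ({#gen_b#}, {{#}, {#gen_b, gen_b#}}), ({#gen_x#}, {{#gen_a#}, {#}}),
      ({#gen_b, gen_b#}, {{#gen_b#}, {#gen_a#}}), ({#}, {{#gen_x#}, {#gen_b#}})}"

lemma heap_opts_eq:
  "heap_opts n =
     (if n = 1 \<or> n = 3 then {{#}} else {}) \<union> (if n > 2 then {heap_word (n - 2)} else {}) \<union>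
     (if n > 3 then {heap_word (n - 3)} else {})"
proof -
  have "{H. heap_move n H} =
     (if n = 1 \<or> n = 3 then {{#}} else {}) \<union> (if n > 2 then {{#n - 2#}} else {}) \<union>
     (if n > 3 then {{#n - 3#}} else {})"
    by (auto simp: heap_move.simps)
  then show ?thesis
    by (simp add: heap_opts_def)
qed

lemma heap_type:
  assumes "n > 0"
  shows "(heap_word n, heap_opts n) \<in> heap_types"
proof (cases "n < 8")
  case True
  then have "n \<in> {1, 2, 3, 4, 5, 6, 7}"
    using assms by auto
  then show ?thesis
    by (elim insertE) (simp_all add: heap_opts_eq heap_word_def heap_types_def insert_commute)
next
  case False
  \<comment> \<open>From 8 counters on, the heap and both of its options have at least 5 counters,
    where \<open>heap_word\<close> has period 5.\<close>
  then obtain q r where n: "n = 8 + (5 * q + r)" and "r < 5"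
    by (metis le_add_diff_inverse mult_div_mod_eq mod_less_divisor not_less zero_less_numeral)
  then have "r \<in> {0, 1, 2, 3, 4}"
    by auto
  then show ?thesis
    unfolding n
    by (elim insertE) (simp_all add: heap_opts_eq heap_word_def heap_types_def insert_commute)
qed

text \<open>This collects options common to all heaps of one value, so that the word of a position
  alone guarantees moves. Only the value b^2 needs an alternative, for the types of the heaps 6 and
  11.\<close>

lemma heap_types_cases:
  assumes "(s, T) \<in> heap_types"
  shows "gen_x \<in># s \<Longrightarrow> s = {#gen_x#} \<and> {#} \<in> T"
    and "gen_a \<in># s \<Longrightarrow> s = {#gen_a#} \<and> {#gen_x#} \<in> T \<and> {#gen_b, gen_b#} \<in> T"
    and "gen_z \<in># s \<Longrightarrow> s = {#gen_z#} \<and> {#} \<in> T \<and> {#gen_x#} \<in> T"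
    and "gen_b \<in># s \<Longrightarrow> s = {#gen_b#} \<and> {#} \<in> T \<and> {#gen_b, gen_b#} \<in> T \<or>
      s = {#gen_b, gen_b#} \<and> ({#gen_z#} \<in> T \<or> {#gen_b#} \<in> T \<and> {#gen_a#} \<in> T)"
    and "s = {#} \<Longrightarrow> t \<in> T \<Longrightarrow> {#gen_x#} \<in> T"
    and "g \<in># s \<Longrightarrow> T \<noteq> {}"
proof -
  have "\<forall>(s, T) \<in> heap_types.
    (gen_x \<in># s \<longrightarrow> s = {#gen_x#} \<and> {#} \<in> T) \<and>
    (gen_a \<in># s \<longrightarrow> s = {#gen_a#} \<and> {#gen_x#} \<in> T \<and> {#gen_b, gen_b#} \<in> T) \<and>
    (gen_z \<in># s \<longrightarrow> s = {#gen_z#} \<and> {#} \<in> T \<and> {#gen_x#} \<in> T) \<and>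
    (gen_b \<in># s \<longrightarrow> s = {#gen_b#} \<and> {#} \<in> T \<and> {#gen_b, gen_b#} \<in> T \<or>
      s = {#gen_b, gen_b#} \<and> ({#gen_z#} \<in> T \<or> {#gen_b#} \<in> T \<and> {#gen_a#} \<in> T)) \<and>
    (T = {} \<or> s \<noteq> {#} \<or> {#gen_x#} \<in> T) \<and> (s = {#} \<or> T \<noteq> {})"
    by (simp add: heap_types_def)
  note this[THEN bspec, OF assms, unfolded prod.case]
  then show "gen_x \<in># s \<Longrightarrow> s = {#gen_x#} \<and> {#} \<in> T"
    and "gen_a \<in># s \<Longrightarrow> s = {#gen_a#} \<and> {#gen_x#} \<in> T \<and> {#gen_b, gen_b#} \<in> T"
    and "gen_z \<in># s \<Longrightarrow> s = {#gen_z#} \<and> {#} \<in> T \<and> {#gen_x#} \<in> T"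
    and "gen_b \<in># s \<Longrightarrow> s = {#gen_b#} \<and> {#} \<in> T \<and> {#gen_b, gen_b#} \<in> T \<or>
      s = {#gen_b, gen_b#} \<and> ({#gen_z#} \<in> T \<or> {#gen_b#} \<in> T \<and> {#gen_a#} \<in> T)"
    and "s = {#} \<Longrightarrow> t \<in> T \<Longrightarrow> {#gen_x#} \<in> T"
    and "g \<in># s \<Longrightarrow> T \<noteq> {}"
    by force+
qed

text \<open>Here \<open>w\<close> is the word of the untouched heaps. For each type and each range
  of exponents of \<open>w\<close>, only a propositional check of parities remains.\<close>

lemma p_word_move:
  assumes "p_word (s + w)" "(s, T) \<in> heap_types" "t \<in> T"
  shows "\<not> p_word (t + w)"
proof -
  have "\<forall>(s, T) \<in> heap_types. \<forall>t\<in>T. p_word (s + w) \<longrightarrow> \<not> p_word (t + w)"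
    unfolding heap_types_def
    by (cases w rule: word_cases) (simp_all add: p_word_iff del: count_eq_zero_iff, argo+)
  then show ?thesis
    using assms by blast
qed

section \<open>Moves read on words\<close>

lemma word_subset_position:
  "n \<in># G \<Longrightarrow> heap_word n \<subseteq># position_word G"
  by (auto dest!: multi_member_split)

lemma in_position_word: "g \<in># position_word G \<longleftrightarrow> (\<exists>n\<in>#G. g \<in># heap_word n)"
  by (induction G) auto

lemma even_count_position_word:
  assumes "\<And>n. n \<in># G \<Longrightarrow> even (count (heap_word n) g)"
  shows "even (count (position_word G) g)"
  using assms by (induction G) auto

lemma move_cases_word:
  assumes "move G G'"
  obtains n t w where "n \<in># G" "t \<in> heap_opts n" "position_word G = heap_word n + w"
    "position_word G' = t + w"
  using assms
proof cases
  case (1 n H R)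
  then show ?thesis
    by (intro that[of n "position_word H" "position_word R"])
      (auto simp: heap_opts_def add.commute)
qed

lemma ex_move_word:
  assumes "n \<in># G" "t \<in> heap_opts n"
  shows "\<exists>G'. move G G' \<and> position_word G' = position_word G - heap_word n + t"
proof -
  obtain R where "G = add_mset n R"
    using assms(1) by (blast dest: multi_member_split)
  moreover obtain H where "heap_move n H" "position_word H = t"
    using assms(2) by (auto simp: heap_opts_def)
  ultimately show ?thesis
    by (intro exI[of _ "R + H"]) (simp add: move.intros)
qed

text \<open>If no move reached a P-word, \<open>p_counts_stuck\<close> would force the empty word,
  so every heap would have value e. A heap of value e that can move has an option of value x, and x
  is a P-word.\<close>

lemma ex_p_move:
  assumes G: "G \<in> carrier positions" and "\<not> p_word (position_word G)" and "move G G0"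
  shows "\<exists>G'. move G G' \<and> p_word (position_word G')"
proof (rule ccontr)
  assume no: "\<nexists>G'. move G G' \<and> p_word (position_word G')"
  let ?w = "position_word G"
  have stuck: "\<not> p_word (?w - heap_word n + t)" if "n \<in># G" "t \<in> heap_opts n" for n t
    using ex_move_word[OF that] no by metis
  have type: "(heap_word n, heap_opts n) \<in> heap_types" if "n \<in># G" for n
    using that G by (intro heap_type) (auto simp: positions_def free_comm_monoid_def)
  have x: "\<not> p_word (?w - {#gen_x#})" if "gen_x \<in># ?w"
    using that stuck heap_types_cases(1)[OF type] unfolding in_position_word
    by (metis add.right_neutral)
  have a: "\<not> p_word (?w - {#gen_a#} + {#gen_x#})" "\<not> p_word (?w - {#gen_a#} + {#gen_b, gen_b#})"
    if "gen_a \<in># ?w"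
    using that stuck heap_types_cases(2)[OF type] unfolding in_position_word by metis+
  have z: "\<not> p_word (?w - {#gen_z#})" "\<not> p_word (?w - {#gen_z#} + {#gen_x#})"
    if "gen_z \<in># ?w"
    using that stuck heap_types_cases(3)[OF type] unfolding in_position_word
    by (metis add.right_neutral)+
  have b: "\<not> p_word (?w - {#gen_b#}) \<and> \<not> p_word (?w - {#gen_b#} + {#gen_b, gen_b#}) \<or>
      even (count ?w gen_b) \<and> (\<not> p_word (?w - {#gen_b, gen_b#} + {#gen_z#}) \<or>
      \<not> p_word (?w - {#gen_b, gen_b#} + {#gen_b#}) \<and> \<not> p_word (?w - {#gen_b, gen_b#} + {#gen_a#}))"
    if gen: "gen_b \<in># ?w"
  proof (cases "\<exists>n\<in>#G. heap_word n = {#gen_b#}")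
    case True
    then obtain n where n: "n \<in># G" "heap_word n = {#gen_b#}"
      by blast
    then have "{#} \<in> heap_opts n" "{#gen_b, gen_b#} \<in> heap_opts n"
      using heap_types_cases(4)[OF type[OF n(1)]] by simp_all
    then show ?thesis
      using n stuck by (metis add.right_neutral)
  next
    \<comment> \<open>Every \<open>b\<close> now comes in a pair from a heap of value b^2, so the
      exponent of \<open>b\<close> is even.\<close>
    case False
    have bb: "heap_word n = {#gen_b, gen_b#} \<and>
        ({#gen_z#} \<in> heap_opts n \<or> {#gen_b#} \<in> heap_opts n \<and> {#gen_a#} \<in> heap_opts n)"
      if "n \<in># G" "gen_b \<in># heap_word n" for n
      using heap_types_cases(4)[OF type] False that by blast
    have "even (count (heap_word n) gen_b)" if "n \<in># G" for n
      using bb[OF that] by (cases "gen_b \<in># heap_word n") (auto simp: not_in_iff)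
    then have "even (count ?w gen_b)"
      by (rule even_count_position_word)
    moreover obtain n where "n \<in># G" "gen_b \<in># heap_word n"
      using gen in_position_word by blast
    ultimately show ?thesis
      using bb stuck by metis
  qed
  have counts: "count ?w gen_x = 0 \<and> count ?w gen_a = 0 \<and> count ?w gen_z = 0 \<and> count ?w gen_b = 0"
  proof (rule p_counts_stuck)
    show "\<not> p_counts (count ?w gen_x) (count ?w gen_a) (count ?w gen_z) (count ?w gen_b)"
      using assms(2) by (simp add: p_word_counts)
    show "\<not> p_counts (count ?w gen_x - 1) (count ?w gen_a) (count ?w gen_z) (count ?w gen_b)"
      if "count ?w gen_x > 0"
      using x that by (simp add: p_word_counts)
    show "\<not> p_counts (count ?w gen_x + 1) (count ?w gen_a - 1) (count ?w gen_z) (count ?w gen_b) \<and>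
        \<not> p_counts (count ?w gen_x) (count ?w gen_a - 1) (count ?w gen_z) (count ?w gen_b + 2)"
      if "count ?w gen_a > 0"
      using a that by (simp add: p_word_counts)
    show "\<not> p_counts (count ?w gen_x) (count ?w gen_a) (count ?w gen_z - 1) (count ?w gen_b) \<and>
        \<not> p_counts (count ?w gen_x + 1) (count ?w gen_a) (count ?w gen_z - 1) (count ?w gen_b)"
      if "count ?w gen_z > 0"
      using z that by (simp add: p_word_counts)
    assume pos: "count ?w gen_b > 0"
    \<comment> \<open>Trading b for b^2 gives l - 1 + 2, and trading b^2 for b gives l - 2 + 1. The
      truncated differences are harmless: l is positive, and at least 2 if even.\<close>
    then have "Suc (Suc (count ?w gen_b - Suc 0)) = Suc (count ?w gen_b)"
      by simp
    moreover have "Suc (count ?w gen_b - Suc (Suc 0)) = count ?w gen_b - Suc 0"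
      if "even (count ?w gen_b)"
      using that pos by presburger
    ultimately show "\<not> p_counts (count ?w gen_x) (count ?w gen_a) (count ?w gen_z) (count ?w gen_b - 1) \<and>
        \<not> p_counts (count ?w gen_x) (count ?w gen_a) (count ?w gen_z) (count ?w gen_b + 1) \<or>
      even (count ?w gen_b) \<and>
        (\<not> p_counts (count ?w gen_x) (count ?w gen_a) (count ?w gen_z + 1) (count ?w gen_b - 2) \<or>
        \<not> p_counts (count ?w gen_x) (count ?w gen_a) (count ?w gen_z) (count ?w gen_b - 1) \<and>
        \<not> p_counts (count ?w gen_x) (count ?w gen_a + 1) (count ?w gen_z) (count ?w gen_b - 2))"
      using b pos by (auto simp: p_word_counts numeral_2_eq_2)
  qed
  have "count ?w g = 0" for g
    using counts by (cases g) blast+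
  then have "?w = {#}"
    by (simp add: multiset_eq_iff del: count_eq_zero_iff)
  obtain n t w where n: "n \<in># G" "t \<in> heap_opts n"
    using \<open>move G G0\<close> by (rule move_cases_word)
  have "heap_word n = {#}"
    using word_subset_position[OF n(1)] \<open>?w = {#}\<close> by simp
  then have "{#gen_x#} \<in> heap_opts n"
    using heap_types_cases(5)[OF type[OF n(1)]] n(2) by blast
  then show False
    using stuck[OF n(1)] \<open>heap_word n = {#}\<close> \<open>?w = {#}\<close> by (force simp: p_word_iff)
qed

lemma misere_outcome_iff:
  assumes "G \<in> carrier positions"
  shows "misere_outcome G = P_position \<longleftrightarrow> p_word (position_word G)"
  using assms
proof (induction "sum_mset G" arbitrary: G rule: less_induct)
  case less
  have IH: "misere_outcome G' = P_position \<longleftrightarrow> p_word (position_word G')" if "move G G'" for G'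
    using that less by (blast intro: move_decreases move_positions)
  have type: "(heap_word n, heap_opts n) \<in> heap_types" if "n \<in># G" for n
    using that less.prems by (intro heap_type) (auto simp: positions_def free_comm_monoid_def)
  show ?case
  proof
    assume "misere_outcome G = P_position"
    then have "\<exists>G'. move G G'" "\<nexists>G'. move G G' \<and> misere_outcome G' = P_position"
      by (simp_all add: misere_outcome.simps[of G] split: if_splits)
    then show "p_word (position_word G)"
      using ex_p_move[OF less.prems] IH by blast
  next
    assume P: "p_word (position_word G)"
    \<comment> \<open>The empty word is not P, so some heap has a nontrivial value and hence a move.
      This excludes positions without moves, which are N under the misere convention.\<close>
    then have "position_word G \<noteq> {#}"
      by (auto simp: p_word_iff)
    then obtain g n where n: "n \<in># G" "g \<in># heap_word n"
      by (metis multiset_nonemptyE in_position_word)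
    from n(2) have "heap_opts n \<noteq> {}"
      by (rule heap_types_cases(6)[OF type[OF n(1)]])
    then have "\<exists>G'. move G G'"
      using ex_move_word[OF n(1)] by blast
    moreover have "\<not> p_word (position_word G')" if "move G G'" for G'
      using that
    proof (rule move_cases_word)
      fix n t w
      assume "n \<in># G" "t \<in> heap_opts n" "position_word G = heap_word n + w"
        "position_word G' = t + w"
      then show ?thesis
        using p_word_move[OF _ type] P by metis
    qed
    ultimately show "misere_outcome G = P_position"
      using IH by (auto simp: misere_outcome.simps[of G])
  qed
qed

section \<open>The isomorphism\<close>

text \<open>The smallest heap of each value.\<close>

fun gen_heap :: "gen \<Rightarrow> nat" where
  "gen_heap gen_x = 1"
| "gen_heap gen_z = 3"
| "gen_heap gen_a = 8"
| "gen_heap gen_b = 9"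

text \<open>This makes the induced map onto and turns every separating word into an actual
  position.\<close>

lemma position_word_surj: "position_word ` carrier positions = UNIV"
proof -
  have "w \<in> position_word ` carrier positions" for w
  proof
    have "gen_heap g > 0" and heap: "heap_word (gen_heap g) = {#g#}" for g
      by (cases g; simp add: heap_word_def)+
    then show "image_mset gen_heap w \<in> carrier positions"
      by (auto simp: positions_def free_comm_monoid_def)
    show "w = position_word (image_mset gen_heap w)"
      by (induction w) (simp_all add: heap)
  qed
  then show ?thesis
    by blast
qed

lemma positions_mult: "u \<otimes>\<^bsub>positions\<^esub> v = u + v"
  by (simp add: positions_def free_comm_monoid_def)

text \<open>Outcomes are read off words, and by surjectivity the test positions run through all
  words, so \<open>p_word_separates\<close> applies.\<close>

lemma misere_congruence_iff:
  assumes u: "u \<in> carrier positions" and v: "v \<in> carrier positions"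
  shows "(u, v) \<in> misere_congruence \<longleftrightarrow> (position_word u, position_word v) \<in> word_congruence"
proof -
  have add: "u + w \<in> carrier positions"
    if "u \<in> carrier positions" "w \<in> carrier positions" for u w
    using that by (auto simp: positions_def free_comm_monoid_def)
  have eq: "misere_outcome (u + w) = misere_outcome (v + w) \<longleftrightarrow>
      p_word (position_word u + position_word w) = p_word (position_word v + position_word w)"
    if "w \<in> carrier positions" for w
    using misere_outcome_iff[OF add[OF u that]] misere_outcome_iff[OF add[OF v that]]
    by (cases "misere_outcome (u + w)"; cases "misere_outcome (v + w)") simp_all
  have "(u, v) \<in> misere_congruence \<longleftrightarrow>
      (\<forall>w \<in> position_word ` carrier positions.
        p_word (position_word u + w) = p_word (position_word v + w))"
    using u v eq by (simp add: misere_congruence_def positions_mult)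
  also have "\<dots> \<longleftrightarrow> word_invariant (position_word u) = word_invariant (position_word v)"
    unfolding position_word_surj
  proof
    assume "word_invariant (position_word u) = word_invariant (position_word v)"
    from word_invariant_add[OF this refl]
    show "\<forall>w\<in>UNIV. p_word (position_word u + w) = p_word (position_word v + w)"
      by (simp add: p_word_def)
  qed (blast intro: p_word_separates)
  finally show ?thesis
    by (simp add: word_congruence_iff)
qed

theorem theorem1:
  shows "comm_monoid misere_quotient \<and>
    comm_monoid (presented_comm_monoid UNIV relations_0123) \<and>
    card (carrier (presented_comm_monoid UNIV relations_0123)) = 20 \<and>
    misere_quotient \<cong> presented_comm_monoid UNIV relations_0123"
proof (intro conjI)
  have positions: "comm_monoid positions"
    unfolding positions_def by (rule comm_monoid_free_comm_monoid)
  show "comm_monoid misere_quotient"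
    unfolding misere_quotient_def
    by (rule comm_monoid_quotient_monoid[OF positions monoid_congruence_misere])
  show "comm_monoid (presented_comm_monoid UNIV relations_0123)"
    unfolding presented_comm_monoid_def
    by (rule comm_monoid_quotient_monoid[OF comm_monoid_free_comm_monoid monoid_congruence_word])
  show "card (carrier (presented_comm_monoid UNIV relations_0123)) = 20"
    by (rule card_presented)
  show "misere_quotient \<cong> presented_comm_monoid UNIV relations_0123"
    unfolding misere_quotient_def presented_comm_monoid_def
  proof (rule quotient_monoid_iso[OF monoid_congruence_misere monoid_congruence_word])
    show "Group.monoid positions"
      using positions by (rule comm_monoid.axioms)
    show "position_word \<in> hom positions words"
      by (auto simp: hom_def positions_mult free_comm_monoid_def)
    show "position_word ` carrier positions = carrier words"
      by (simp add: position_word_surj free_comm_monoid_def)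
  qed (rule misere_congruence_iff)
qed

end
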